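(* Let $m\ge2$, let $\Omega_1,\ldots,\Omega_m\subset\mathbb{R}^n$, and let $\bar{x}$ be a rated extremal point of rank $\alpha\in[0,1)$ for the system $\{\Omega_1,\ldots,\Omega_m\}$. Assume that all the sets $\Omega_i$ are locally closed around $\bar{x}$. Then the exact extremal principle holds for $\{\Omega_1,\ldots,\Omega_m\}$ at $\bar{x}$, i.e., there are $x_i^*\in N(\bar{x};\Omega_i)$ for $i=1,\ldots,m$ satisfying $$x_1^*+\ldots+x_m^*=0\quad\text{and}\quad\|x_1^*\|^2+\ldots+\|x_m^*\|^2=1.$$
   Context: $\mathbb{R}^n$ carries the Euclidean norm; $B(\bar{x},\rho)$ is the closed ball centered at $\bar{x}$ with radius $\rho$. Rated extremality: for nonempty sets $\Omega_1,\ldots,\Omega_m\subset X$ with common point $\bar{x}$, $\bar{x}$ is a rated extremal point of rank $\alpha$, $0\le\alpha<1$, of $\{\Omega_1,\ldots,\Omega_m\}$ if there are $\gamma>0$ and sequences $\{a_{ik}\}_{k\in\mathbb{N}}\subset X$, $i=1,\ldots,m$, such that $r_k:=\max_i\|a_{ik}\|\to0$ as $k\to\infty$ and $\bigcap_{i=1}^m(\Omega_i-a_{ik})\cap B(\bar{x},\gamma r_k^\alpha)=\emptyset$ for all large $k\in\mathbb{N}$. Limiting (basic, Mordukhovich) normal cone: for $\Omega\subset X$ and $\varepsilon\ge0$ put $\widehat{N}_\varepsilon(x;\Omega):=\{x^*\in X^*\mid\limsup_{u\to x,\,u\in\Omega}\frac{\langle x^*,u-x\rangle}{\|u-x\|}\le\varepsilon\}$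 if $x\in\Omega$ and $\widehat{N}_\varepsilon(x;\Omega):=\emptyset$ if $x\notin\Omega$. Then $N(\bar{x};\Omega)$ is the set of all $x^*\in X^*$ for which there are sequences $\varepsilon_k\downarrow0$, $x_k\to\bar{x}$ and $x_k^*\to x^*$ (weak$^*$) with $x_k^*\in\widehat{N}_{\varepsilon_k}(x_k;\Omega)$ for all $k\in\mathbb{N}$. For $X=\mathbb{R}^n$ and $\Omega$ locally closed around $\bar{x}$, equivalently, $N(\bar{x};\Omega)$ is the set of limits of sequences $x_k^*\in\operatorname{cone}[x_k-\Pi(x_k;\Omega)]$ with $x_k\to\bar{x}$, where $\Pi(x;\Omega):=\{w\in\Omega\mid\|x-w\|=\operatorname{dist}(x;\Omega)\}$ and $\operatorname{cone}A:=\bigcup_{\lambda\ge0}\lambda A$. *)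

theory Defs
  imports "HOL-Analysis.Analysis"
begin

definition locally_closed_around :: "'a::real_normed_vector set \<Rightarrow> 'a \<Rightarrow> bool" where
  "locally_closed_around \<Omega> x \<longleftrightarrow> (\<exists>\<rho>>0. closed (\<Omega> \<inter> cball x \<rho>))"

text \<open>
  In the following definition the point \<open>xbar\<close> lies in every translated set whose translation
  vector vanishes, so the intersection is nonempty whenever \<open>r k = 0\<close>. Hence \<open>r k > 0\<close> for all
  large \<open>k\<close>, and the convention \<open>0 powr 0 = 0\<close> is immaterial for \<open>\<alpha> = 0\<close>.
\<close>

definition rated_extremal_point ::
    "real \<Rightarrow> nat \<Rightarrow> (nat \<Rightarrow> 'a::real_normed_vector set) \<Rightarrow> 'a \<Rightarrow> bool" where
  "rated_extremal_point \<alpha> m \<Omega> xbar \<longleftrightarrow>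
     0 \<le> \<alpha> \<and> \<alpha> < 1 \<and> (\<forall>i\<in>{1..m}. xbar \<in> \<Omega> i) \<and>
     (\<exists>\<gamma>>0. \<exists>a :: nat \<Rightarrow> nat \<Rightarrow> 'a.
        let r = (\<lambda>k. Max ((\<lambda>i. norm (a i k)) ` {1..m})) in
          r \<longlonglongrightarrow> 0 \<and>
          (\<forall>\<^sub>F k in sequentially.
             (\<Inter>i\<in>{1..m}. (\<lambda>w. w - a i k) ` \<Omega> i) \<inter> cball xbar (\<gamma> * r k powr \<alpha>) = {}))"

text \<open>
  The dual space is identified with the space itself through the inner product; in finite
  dimension weak* convergence is then norm convergence. The upper limit is taken in the extended
  reals, so it is \<open>-\<infinity>\<close> at an isolated point of \<open>\<Omega>\<close>, where every vector is therefore a normal.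
\<close>

definition eps_normals :: "real \<Rightarrow> 'a::euclidean_space \<Rightarrow> 'a set \<Rightarrow> 'a set" where
  "eps_normals \<epsilon> x \<Omega> =
     (if x \<in> \<Omega>
      then {v. Limsup (at x within \<Omega>) (\<lambda>u. ereal (v \<bullet> (u - x) / norm (u - x))) \<le> ereal \<epsilon>}
      else {})"

definition limiting_normal_cone :: "'a::euclidean_space \<Rightarrow> 'a set \<Rightarrow> 'a set" where
  "limiting_normal_cone xbar \<Omega> =
     {v. \<exists>(\<epsilon> :: nat \<Rightarrow> real) (x :: nat \<Rightarrow> 'a) (y :: nat \<Rightarrow> 'a).
           (\<forall>k. 0 \<le> \<epsilon> k) \<and> decseq \<epsilon> \<and> \<epsilon> \<longlonglongrightarrow> 0 \<and> x \<longlonglongrightarrow> xbar \<and> y \<longlonglongrightarrow> v \<and>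
           (\<forall>k. y k \<in> eps_normals (\<epsilon> k) (x k) \<Omega>)}"

end

theory Submission
  imports Defs
begin

text \<open>
  Each translation with empty intersection gives a minimization problem: over the ball
  \<open>cball xbar R\<close> minimize the Euclidean norm of the vector of distances from \<open>x + a i\<close> to
  \<open>\<Omega> i\<close>, plus a quadratic penalty in \<open>x - xbar\<close>. The value at \<open>xbar\<close> is at most \<open>sqrt m * r\<close>, so a
  penalty factor of order \<open>r / R\<^sup>2\<close> forces the minimizer into the interior, and the gradient of the
  penalty there is of order \<open>r / R\<close>. Since the sum of distances does not vanish on the ball,
  stationarity yields normalized proximal normals whose sum is of order \<open>r / R\<close>. For
  \<open>R = \<gamma> * r powr \<alpha>\<close> with \<open>\<alpha> < 1\<close> this tends to zero, and compactness gives the exact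
  normals in the limit.
\<close>

section \<open>Proximal normals as regular normals\<close>

text \<open>Near \<open>w\<close> no point of the set enters the open ball around \<open>z\<close>
  through \<open>w\<close>. Expanding the squared norm turns this into a bound on the inner product
  that is quadratic in \<open>u - w\<close>, so the difference quotient is at most
  \<open>c * norm (u - w)\<close>. Minimality is asked only near \<open>w\<close>, so that it can be
  checked on a bounded piece of the set.\<close>

lemma proximal_imp_eps_normal:
  fixes w z :: "'a::euclidean_space"
  assumes "w \<in> \<Omega>" and "c \<ge> 0" and "\<delta> > 0"
    and nearest: "\<And>u. u \<in> \<Omega> \<Longrightarrow> dist u w < \<delta> \<Longrightarrow> norm (z - w) \<le> norm (z - u)"
  shows "c *\<^sub>R (z - w) \<in> eps_normals 0 w \<Omega>"
proof -
  let ?q = "\<lambda>u. ereal (c *\<^sub>R (z - w) \<bullet> (u - w) / norm (u - w))"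
  have "Limsup (at w within \<Omega>) ?q \<le> ereal e" if "e > 0" for e
  proof (rule Limsup_bounded)
    \<comment> \<open>The second bound makes \<open>c * norm (u - w)\<close> at most
      \<open>e\<close>; the summand \<open>1\<close> covers \<open>c = 0\<close>.\<close>
    define d where "d = min \<delta> (e / (c + 1))"
    have "d > 0"
      using assms that by (simp add: d_def)
    have "?q u \<le> ereal e" if u: "u \<in> \<Omega>" "u \<noteq> w" "dist u w < d" for u
    proof -
      have "(norm (z - w))\<^sup>2 \<le> (norm (z - u))\<^sup>2"
        using nearest u by (simp add: d_def)
      also have "z - u = (z - w) - (u - w)"
        by simp
      also have "(norm ((z - w) - (u - w)))\<^sup>2
          = (norm (z - w))\<^sup>2 - 2 * ((z - w) \<bullet> (u - w)) + (norm (u - w))\<^sup>2"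
        by (simp only: power2_norm_eq_inner inner_diff_left[of "z - w"] inner_diff_right[of _ "z - w"]
            inner_commute[of "u - w" "z - w"])
      finally have "(z - w) \<bullet> (u - w) \<le> (norm (u - w))\<^sup>2"
        using zero_le_power2[of "norm (u - w)"] by linarith
      then have "c * ((z - w) \<bullet> (u - w)) \<le> c * (norm (u - w))\<^sup>2"
        using \<open>c \<ge> 0\<close> by (rule mult_left_mono)
      then have "c * ((z - w) \<bullet> (u - w)) / norm (u - w) \<le> c * norm (u - w)"
        using u by (simp add: divide_simps power2_eq_square mult.assoc)
      also have "\<dots> \<le> (c + 1) * (e / (c + 1))"
        using u \<open>c \<ge> 0\<close> by (intro mult_mono) (auto simp: d_def dist_norm)
      also have "\<dots> = e"
        using \<open>c \<ge> 0\<close> by simp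
      finally show ?thesis
        by simp
    qed
    then show "\<forall>\<^sub>F u in at w within \<Omega>. ?q u \<le> ereal e"
      unfolding eventually_at using \<open>d > 0\<close> by blast
  qed
  then have "Limsup (at w within \<Omega>) ?q \<le> 0"
    by (intro ereal_le_epsilon2[where y = 0]) simp
  then show ?thesis
    using \<open>w \<in> \<Omega>\<close> by (simp add: eps_normals_def zero_ereal_def)
qed

section \<open>Simultaneous compactness for finitely many sequences\<close>

text \<open>Each new index is handled by thinning out the subsequence found so far, which preserves
  the limits already obtained.\<close>

lemma common_convergent_subsequence:
  fixes y :: "'i \<Rightarrow> nat \<Rightarrow> 'a::heine_borel"
  assumes "finite I" and "\<And>i. i \<in> I \<Longrightarrow> bounded (range (y i))"
  shows "\<exists>s l. strict_mono (s :: nat \<Rightarrow> nat) \<and> (\<forall>i\<in>I. (y i \<circ> s) \<longlonglongrightarrow> l i)"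
  using assms
proof (induction I rule: finite_induct)
  case empty
  then show ?case
    using strict_mono_id by auto
next
  case (insert j I)
  have "\<exists>s l. strict_mono (s :: nat \<Rightarrow> nat) \<and> (\<forall>i\<in>I. (y i \<circ> s) \<longlonglongrightarrow> l i)"
    using insert.prems by (intro insert.IH) simp
  then obtain s l where s: "strict_mono s" "\<forall>i\<in>I. (y i \<circ> s) \<longlonglongrightarrow> l i"
    by (elim exE conjE)
  have "bounded (range (y j \<circ> s))"
    using insert.prems[of j] by (auto intro: bounded_subset)
  then obtain p t where t: "strict_mono t" "(y j \<circ> s \<circ> t) \<longlonglongrightarrow> p"
    using bounded_imp_convergent_subsequence by blast
  have "(y i \<circ> (s \<circ> t)) \<longlonglongrightarrow> (if i = j then p else l i)" if "i \<in> insert j I" for i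
    using that s t LIMSEQ_subseq_LIMSEQ[OF _ t(1)] by (auto simp: o_assoc)
  then show ?case
    using strict_mono_o[OF s(1) t(1)] by (intro exI conjI ballI)
qed

section \<open>The penalized minimization problem\<close>

text \<open>This is Fermat's rule at \<open>h = 0\<close>: since the Euclidean norm of the family is
  positive, the root is differentiable there, with gradient the sum of the \<open>p i\<close>
  divided by that norm, while the penalty has gradient \<open>2 * c * q\<close>.\<close>

lemma stationary_norm_sum:
  fixes p :: "'i \<Rightarrow> 'a::real_inner"
  assumes "L2_set (\<lambda>i. norm (p i)) I > 0" and "\<delta> > 0"
    and min: "\<And>h. norm h < \<delta> \<Longrightarrow>
      L2_set (\<lambda>i. norm (p i)) I + c * (norm q)\<^sup>2
        \<le> L2_set (\<lambda>i. norm (p i + h)) I + c * (norm (q + h))\<^sup>2"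
  shows "(\<Sum>i\<in>I. p i) = - (2 * c * L2_set (\<lambda>i. norm (p i)) I) *\<^sub>R q"
proof -
  define S where "S = L2_set (\<lambda>i. norm (p i)) I"
  \<comment> \<open>This is \<open>S\<close> times the gradient. Along this single direction the
    derivative vanishes only if \<open>v \<bullet> v = 0\<close>, so calculus in one real variable
    suffices.\<close>
  define v where "v = (\<Sum>i\<in>I. p i) + (2 * c * S) *\<^sub>R q"
  define \<phi> where "\<phi> t = L2_set (\<lambda>i. norm (p i + t *\<^sub>R v)) I + c * (norm (q + t *\<^sub>R v))\<^sup>2" for t
  have S: "S = sqrt (\<Sum>i\<in>I. p i \<bullet> p i)" "S > 0"
    using assms(1) by (simp_all add: S_def L2_set_def power2_norm_eq_inner)
  have expand: "(b + t *\<^sub>R v) \<bullet> (b + t *\<^sub>R v) = b \<bullet> b + t * (2 * (b \<bullet> v)) + t\<^sup>2 * (v \<bullet> v)" for b t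
    by (simp add: inner_add_left inner_add_right inner_commute power2_eq_square algebra_simps)
  have \<phi>: "\<phi> = (\<lambda>t. sqrt ((\<Sum>i\<in>I. p i \<bullet> p i) + t * (2 * ((\<Sum>i\<in>I. p i) \<bullet> v))
                  + t\<^sup>2 * (\<Sum>i\<in>I. v \<bullet> v))
                + c * (q \<bullet> q + t * (2 * (q \<bullet> v)) + t\<^sup>2 * (v \<bullet> v)))"
    unfolding \<phi>_def L2_set_def power2_norm_eq_inner expand
    by (simp add: sum.distrib inner_sum_left sum_distrib_left del: sum_constant)
  have "(\<phi> has_real_derivative ((\<Sum>i\<in>I. p i) \<bullet> v) / S + c * (2 * (q \<bullet> v))) (at 0)"
    unfolding \<phi> using S
    by (auto intro!: derivative_eq_intros simp: field_simps)
  moreover have "\<phi> 0 \<le> \<phi> t" if "\<bar>0 - t\<bar> < \<delta> / (norm v + 1)" for t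
  proof -
    have "norm (t *\<^sub>R v) \<le> \<bar>t\<bar> * (norm v + 1)"
      by (simp add: mult_left_mono)
    also have "\<dots> < \<delta>"
      using that by (simp add: pos_less_divide_eq add_nonneg_pos)
    finally show ?thesis
      using min[of "t *\<^sub>R v"] by (simp add: \<phi>_def)
  qed
  ultimately have "((\<Sum>i\<in>I. p i) \<bullet> v) / S + c * (2 * (q \<bullet> v)) = 0"
    using \<open>\<delta> > 0\<close> by (intro DERIV_local_min[of \<phi> _ 0 "\<delta> / (norm v + 1)"]) (auto simp: add_nonneg_pos)
  then have "v \<bullet> v = 0"
    using S by (simp add: v_def inner_add_left field_simps)
  then show ?thesis
    by (simp add: v_def S_def add_eq_0_iff)
qed

lemma translated_sets_near_stationary:
  fixes C :: "'i \<Rightarrow> 'a::euclidean_space set"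
  assumes "finite I" "\<And>i. i \<in> I \<Longrightarrow> closed (C i)" "\<And>i. i \<in> I \<Longrightarrow> xbar \<in> C i"
    and "r > 0" "R > 0" "I \<noteq> {}"
    and a: "\<And>i. i \<in> I \<Longrightarrow> norm (a i) \<le> r"
    and empty: "\<And>x. dist xbar x \<le> R \<Longrightarrow> \<exists>i\<in>I. x + a i \<notin> C i"
  shows "\<exists>x w. dist xbar x \<le> R \<and> (\<forall>i\<in>I. w i \<in> C i)
    \<and> (\<forall>i\<in>I. \<forall>u\<in>C i. norm (x + a i - w i) \<le> norm (x + a i - u))
    \<and> L2_set (\<lambda>i. norm (x + a i - w i)) I > 0
    \<and> norm (\<Sum>i\<in>I. x + a i - w i)
       \<le> 4 * sqrt (card I) * r / R * L2_set (\<lambda>i. norm (x + a i - w i)) I"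
proof -
  define K where "K = sqrt (card I) * r"
  \<comment> \<open>\<open>K\<close> bounds the value at \<open>xbar\<close>. On the sphere of
    radius \<open>R\<close> the penalty is \<open>2 * K\<close>, which keeps the minimizer off the
    boundary, and the penalty gradient is at most \<open>2 * c * R = 4 * K / R\<close>.\<close>
  define c where "c = 2 * K / R\<^sup>2"
  define f where "f x = L2_set (\<lambda>i. infdist (x + a i) (C i)) I + c * (norm (x - xbar))\<^sup>2" for x
  have "K > 0"
    using assms by (simp add: K_def card_gt_0_iff)
  then have "c > 0"
    using \<open>R > 0\<close> by (simp add: c_def)
  have "continuous_on (cball xbar R) f"
    unfolding f_def L2_set_def by (intro continuous_intros)
  moreover have "cball xbar R \<noteq> {}"
    using \<open>R > 0\<close> by simp
  ultimately have "\<exists>x\<in>cball xbar R. \<forall>u\<in>cball xbar R. f x \<le> f u"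
    by (intro continuous_attains_inf compact_cball)
  then obtain x where x: "x \<in> cball xbar R" "\<And>u. u \<in> cball xbar R \<Longrightarrow> f x \<le> f u"
    by blast
  have "\<exists>w. w \<in> C i \<and> infdist (x + a i) (C i) = dist (x + a i) w" if "i \<in> I" for i
    using infdist_attains_inf[OF assms(2)[OF that], of "x + a i"] assms(3)[OF that] by blast
  then obtain w where w: "\<And>i. i \<in> I \<Longrightarrow> w i \<in> C i"
    "\<And>i. i \<in> I \<Longrightarrow> infdist (x + a i) (C i) = norm (x + a i - w i)"
    unfolding dist_norm by moura
  have nearest: "norm (x + a i - w i) \<le> norm (x + a i - u)" if "i \<in> I" "u \<in> C i" for i u
    using infdist_le[OF that(2), of "x + a i"] w(2)[OF that(1)] by (simp add: dist_norm)
  define S where "S = L2_set (\<lambda>i. norm (x + a i - w i)) I"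
  have f_x: "f x = S + c * (norm (x - xbar))\<^sup>2"
    unfolding f_def S_def using w by (simp cong: L2_set_cong)
  \<comment> \<open>If all distances vanished, \<open>x\<close> would lie in all the translated
    sets.\<close>
  have "S \<noteq> 0"
  proof
    assume "S = 0"
    then have "\<forall>i\<in>I. x + a i = w i"
      using \<open>finite I\<close> by (simp add: S_def L2_set_eq_0_iff)
    with w(1) show False
      using empty[of x] x(1) by auto
  qed
  then have "S > 0"
    by (simp add: S_def order_less_le)
  have "f xbar \<le> K"
  proof -
    have "f xbar \<le> L2_set (\<lambda>i. r) I"
      unfolding f_def using order_trans[OF infdist_le[OF assms(3)], of _ "xbar + a _"] a
      by (auto intro!: L2_set_mono infdist_nonneg simp: dist_norm)
    also have "\<dots> = K"
      using \<open>r > 0\<close> by (simp add: L2_set_constant K_def)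
    finally show ?thesis .
  qed
  with x(2)[of xbar] f_x \<open>S > 0\<close> \<open>R > 0\<close> have "c * (norm (x - xbar))\<^sup>2 < K"
    by simp
  also have "K \<le> c * R\<^sup>2"
    using \<open>K > 0\<close> \<open>R > 0\<close> by (simp add: c_def)
  finally have interior: "norm (x - xbar) < R"
    using \<open>c > 0\<close> \<open>R > 0\<close> by (simp add: power_less_imp_less_base)
  have "(\<Sum>i\<in>I. x + a i - w i) = - (2 * c * S) *\<^sub>R (x - xbar)"
    unfolding S_def
  proof (rule stationary_norm_sum)
    show "R - norm (x - xbar) > 0"
      using interior by simp
    show "L2_set (\<lambda>i. norm (x + a i - w i)) I > 0"
      using \<open>S > 0\<close> by (simp add: S_def)
    fix h :: 'a
    assume h: "norm h < R - norm (x - xbar)"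
    have "norm (xbar - (x + h)) \<le> norm (x - xbar) + norm h"
      by (metis add_diff_eq norm_minus_commute norm_triangle_ineq diff_add_eq)
    then have "f x \<le> f (x + h)"
      using h by (intro x(2)) (simp add: dist_norm)
    \<comment> \<open>Distance functions need not be differentiable. With the nearest points
      \<open>w i\<close> frozen, a majorant of \<open>f\<close> arises that agrees with
      \<open>f\<close> at \<open>x\<close>, is smooth near \<open>x\<close>, and inherits the local
      minimum.\<close>
    also have "f (x + h) \<le> L2_set (\<lambda>i. norm (x + a i - w i + h)) I + c * (norm (x - xbar + h))\<^sup>2"
    proof -
      have "infdist (x + h + a i) (C i) \<le> norm (x + a i - w i + h)" if "i \<in> I" for i
        using infdist_le[OF w(1)[OF that], of "x + h + a i"] by (simp add: dist_norm algebra_simps)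
      then show ?thesis
        unfolding f_def by (auto intro!: add_mono L2_set_mono infdist_nonneg simp: algebra_simps)
    qed
    finally show "L2_set (\<lambda>i. norm (x + a i - w i)) I + c * (norm (x - xbar))\<^sup>2
        \<le> L2_set (\<lambda>i. norm (x + a i - w i + h)) I + c * (norm (x - xbar + h))\<^sup>2"
      by (simp add: f_x S_def)
  qed
  then have "norm (\<Sum>i\<in>I. x + a i - w i) = 2 * c * S * norm (x - xbar)"
    using \<open>c > 0\<close> \<open>S > 0\<close> by simp
  also have "\<dots> \<le> 2 * c * S * R"
    using interior \<open>c > 0\<close> \<open>S > 0\<close> by (intro mult_left_mono) auto
  also have "\<dots> = 4 * sqrt (card I) * r / R * S"
    using \<open>R > 0\<close> by (simp add: c_def K_def power2_eq_square field_simps)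
  finally show ?thesis
    using x(1) w(1) nearest \<open>S > 0\<close> unfolding S_def mem_cball by blast
qed

section \<open>Approximate normals for locally closed sets\<close>

text \<open>Cutting the sets down to \<open>cball xbar \<rho>\<close> makes them closed and keeps
  the intersection of the translates empty on the small ball. The nearest points stay in the
  interior of the large ball, so the normals found there are normals to the original sets. Division
  by \<open>S\<close> normalizes them.\<close>

lemma translated_sets_approximate_normals:
  fixes \<Omega> :: "'i \<Rightarrow> 'a::euclidean_space set"
  assumes "finite I" "I \<noteq> {}"
    and closed: "\<And>i. i \<in> I \<Longrightarrow> closed (\<Omega> i \<inter> cball xbar \<rho>)"
    and xbar: "\<And>i. i \<in> I \<Longrightarrow> xbar \<in> \<Omega> i"
    and "r > 0" "R > 0" "2 * (R + r) < \<rho>"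
    and a: "\<And>i. i \<in> I \<Longrightarrow> norm (a i) \<le> r"
    and empty: "\<And>x. dist xbar x \<le> R \<Longrightarrow> \<exists>i\<in>I. x + a i \<notin> \<Omega> i"
  shows "\<exists>w y. (\<forall>i\<in>I. dist xbar (w i) \<le> 2 * (R + r))
    \<and> (\<forall>i\<in>I. y i \<in> eps_normals 0 (w i) (\<Omega> i))
    \<and> norm (\<Sum>i\<in>I. y i) \<le> 4 * sqrt (card I) * r / R \<and> (\<Sum>i\<in>I. (norm (y i))\<^sup>2) = 1"
proof -
  define C where "C i = \<Omega> i \<inter> cball xbar \<rho>" for i
  have closed_C: "\<And>i. i \<in> I \<Longrightarrow> closed (C i)" and xbar_C: "\<And>i. i \<in> I \<Longrightarrow> xbar \<in> C i"
    using closed xbar \<open>2 * (R + r) < \<rho>\<close> \<open>r > 0\<close> \<open>R > 0\<close> by (auto simp: C_def)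
  have empty_C: "\<exists>i\<in>I. x + a i \<notin> C i" if "dist xbar x \<le> R" for x
    using empty[OF that] by (auto simp: C_def)
  obtain x w where x: "dist xbar x \<le> R" and w: "\<And>i. i \<in> I \<Longrightarrow> w i \<in> C i"
    and nearest: "\<And>i u. i \<in> I \<Longrightarrow> u \<in> C i \<Longrightarrow> norm (x + a i - w i) \<le> norm (x + a i - u)"
    and pos: "L2_set (\<lambda>i. norm (x + a i - w i)) I > 0"
    and sum: "norm (\<Sum>i\<in>I. x + a i - w i)
       \<le> 4 * sqrt (card I) * r / R * L2_set (\<lambda>i. norm (x + a i - w i)) I"
    using translated_sets_near_stationary[OF \<open>finite I\<close> closed_C xbar_C \<open>r > 0\<close> \<open>R > 0\<close>
        \<open>I \<noteq> {}\<close> a empty_C] by blast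
  define S where "S = L2_set (\<lambda>i. norm (x + a i - w i)) I"
  define y where "y i = (1 / S) *\<^sub>R (x + a i - w i)" for i
  have "S > 0"
    using pos by (simp add: S_def)
  \<comment> \<open>As \<open>xbar\<close> competes in the projection, \<open>w i\<close> is no
    farther from \<open>x + a i\<close> than \<open>xbar\<close> is, which is at most
    \<open>R + r\<close>.\<close>
  have near: "dist xbar (w i) \<le> 2 * (R + r)" if "i \<in> I" for i
  proof -
    have "norm (x + a i - xbar) \<le> norm (x - xbar) + norm (a i)"
      by (metis add_diff_eq diff_add_eq norm_triangle_ineq)
    also have "\<dots> \<le> R + r"
      using x a[OF that] by (simp add: dist_norm norm_minus_commute)
    finally have "norm (x + a i - xbar) \<le> R + r" .
    moreover have "norm (x + a i - w i) \<le> norm (x + a i - xbar)"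
      using nearest that xbar_C by blast
    moreover have "dist xbar (w i) \<le> dist (x + a i) xbar + dist (x + a i) (w i)"
      by (metis dist_commute dist_triangle)
    ultimately show ?thesis
      by (simp add: dist_norm)
  qed
  moreover have "y i \<in> eps_normals 0 (w i) (\<Omega> i)" if i: "i \<in> I" for i
    unfolding y_def
  proof (rule proximal_imp_eps_normal)
    show "w i \<in> \<Omega> i" "1 / S \<ge> 0"
      using w[OF i] \<open>S > 0\<close> by (auto simp: C_def)
    \<comment> \<open>Points of \<open>\<Omega> i\<close> within this distance of \<open>w i\<close>
      still lie in \<open>cball xbar \<rho>\<close>.\<close>
    show "\<rho> - 2 * (R + r) > 0"
      using assms by simp
    fix u assume "u \<in> \<Omega> i" "dist u (w i) < \<rho> - 2 * (R + r)"
    then have "u \<in> C i"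
      using near[OF i] dist_triangle[of xbar u "w i"] by (simp add: C_def dist_commute)
    then show "norm (x + a i - w i) \<le> norm (x + a i - u)"
      by (rule nearest[OF i])
  qed
  moreover have "norm (\<Sum>i\<in>I. y i) \<le> 4 * sqrt (card I) * r / R"
    using sum \<open>S > 0\<close> unfolding y_def scaleR_sum_right[symmetric] S_def[symmetric]
    by (simp add: pos_divide_le_eq)
  moreover have "(\<Sum>i\<in>I. (norm (y i))\<^sup>2) = 1"
  proof -
    have "(\<Sum>i\<in>I. (norm (x + a i - w i))\<^sup>2) = S\<^sup>2"
      by (simp add: S_def L2_set_def sum_nonneg)
    then show ?thesis
      using \<open>S > 0\<close> unfolding y_def
      by (simp add: power_divide sum_divide_distrib[symmetric])
  qed
  ultimately show ?thesis
    by blast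
qed

lemma common_closed_cball:
  fixes \<Omega> :: "'i \<Rightarrow> 'a::real_normed_vector set"
  assumes "finite I" "\<forall>i\<in>I. locally_closed_around (\<Omega> i) xbar"
  obtains \<rho> where "\<rho> > 0" "\<And>i. i \<in> I \<Longrightarrow> closed (\<Omega> i \<inter> cball xbar \<rho>)"
proof -
  obtain \<sigma> where \<sigma>: "\<forall>i\<in>I. \<sigma> i > 0 \<and> closed (\<Omega> i \<inter> cball xbar (\<sigma> i))"
    using assms(2) unfolding locally_closed_around_def by metis
  \<comment> \<open>The element \<open>1\<close> keeps the minimum meaningful when \<open>I\<close>
    is empty.\<close>
  define \<rho> where "\<rho> = Min (insert 1 (\<sigma> ` I))"
  have "closed (\<Omega> i \<inter> cball xbar \<rho>)" if "i \<in> I" for i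
  proof -
    have "\<rho> \<le> \<sigma> i"
      using that \<open>finite I\<close> by (simp add: \<rho>_def)
    then have "\<Omega> i \<inter> cball xbar \<rho> = (\<Omega> i \<inter> cball xbar (\<sigma> i)) \<inter> cball xbar \<rho>"
      by auto
    then show ?thesis
      using \<sigma> that by (metis closed_Int closed_cball)
  qed
  moreover have "\<rho> > 0"
    using \<sigma> \<open>finite I\<close> by (auto simp: \<rho>_def)
  ultimately show ?thesis
    by (intro that)
qed

section \<open>Choice of a translation from the rate of extremality\<close>

lemma rated_extremal_approximate_normals:
  fixes \<Omega> :: "nat \<Rightarrow> 'a::euclidean_space set"
  assumes "m \<ge> 1" and rated: "rated_extremal_point \<alpha> m \<Omega> xbar"
    and closed: "\<forall>i\<in>{1..m}. locally_closed_around (\<Omega> i) xbar"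
    and "e > 0"
  shows "\<exists>w y. (\<forall>i\<in>{1..m}. dist xbar (w i) < e \<and> y i \<in> eps_normals 0 (w i) (\<Omega> i))
    \<and> norm (\<Sum>i=1..m. y i) < e \<and> (\<Sum>i=1..m. (norm (y i))\<^sup>2) = 1"
proof -
  define I where "I = {1..m}"
  have I: "finite I" "I \<noteq> {}" "card I = m"
    using \<open>m \<ge> 1\<close> by (auto simp: I_def)
  obtain \<gamma> a where \<alpha>: "0 \<le> \<alpha>" "\<alpha> < 1" and xbar: "\<And>i. i \<in> I \<Longrightarrow> xbar \<in> \<Omega> i" and "\<gamma> > 0"
    and lim: "(\<lambda>k. Max ((\<lambda>i. norm (a i k)) ` I)) \<longlonglongrightarrow> 0"
    and empty: "\<forall>\<^sub>F k in sequentially. (\<Inter>i\<in>I. (\<lambda>w. w - a i k) ` \<Omega> i)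
             \<inter> cball xbar (\<gamma> * Max ((\<lambda>i. norm (a i k)) ` I) powr \<alpha>) = {}"
    using rated unfolding rated_extremal_point_def Let_def I_def by blast
  define r where "r k = Max ((\<lambda>i. norm (a i k)) ` I)" for k
  have r: "norm (a i k) \<le> r k" if "i \<in> I" for i k
    using I that by (simp add: r_def)
  have r_nonneg: "r k \<ge> 0" for k
    using I(2) r order_trans[OF norm_ge_zero] by blast
  obtain \<rho> where \<rho>: "\<rho> > 0" "\<And>i. i \<in> I \<Longrightarrow> closed (\<Omega> i \<inter> cball xbar \<rho>)"
    using common_closed_cball[OF I(1)] closed unfolding I_def by blast
  \<comment> \<open>If \<open>R\<close> is at most \<open>\<delta>\<close> and \<open>r k\<close> is
    below it, then \<open>2 * (R + r k)\<close> is less than half of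
    \<open>min e \<rho>\<close>.\<close>
  define \<delta> where "\<delta> = min e \<rho> / 8"
  have "\<delta> > 0"
    using \<open>e > 0\<close> \<rho> by (simp add: \<delta>_def)
  \<comment> \<open>Chosen so that \<open>r k < \<eta> * R\<close> says exactly that the bound on
    the norm of the sum is below \<open>e\<close>.\<close>
  define \<eta> where "\<eta> = e / (4 * sqrt (real m))"
  have "\<eta> > 0"
    using \<open>e > 0\<close> \<open>m \<ge> 1\<close> by (simp add: \<eta>_def)
  have lim_r: "r \<longlonglongrightarrow> 0"
    using lim unfolding r_def .
  \<comment> \<open>Here the rank being less than one enters: the exponent is positive.\<close>
  moreover have "(\<lambda>k. r k powr (1 - \<alpha>)) \<longlonglongrightarrow> 0"
    using tendsto_powr'[OF lim_r tendsto_const[of "1 - \<alpha>"]] \<alpha> r_nonneg by simp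
  \<comment> \<open>The first bound controls the location of the normals; the other two give
    \<open>r k < \<eta> * R\<close> in the two cases of the minimum that defines \<open>R\<close>
    below.\<close>
  ultimately have "\<forall>\<^sub>F k in sequentially. r k < \<delta>" "\<forall>\<^sub>F k in sequentially. r k < \<eta> * \<delta>"
    "\<forall>\<^sub>F k in sequentially. r k powr (1 - \<alpha>) < \<eta> * \<gamma>"
    using \<open>\<delta> > 0\<close> \<open>\<eta> > 0\<close> \<open>\<gamma> > 0\<close> by (auto intro: order_tendstoD(2))
  with empty have "\<forall>\<^sub>F k in sequentially. (\<Inter>i\<in>I. (\<lambda>w. w - a i k) ` \<Omega> i)
             \<inter> cball xbar (\<gamma> * r k powr \<alpha>) = {} \<and> r k < \<delta> \<and> r k < \<eta> * \<delta>
             \<and> r k powr (1 - \<alpha>) < \<eta> * \<gamma>"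
    unfolding r_def by eventually_elim simp
  from eventually_happens'[OF sequentially_bot this]
  obtain k where k: "(\<Inter>i\<in>I. (\<lambda>w. w - a i k) ` \<Omega> i) \<inter> cball xbar (\<gamma> * r k powr \<alpha>) = {}"
    "r k < \<delta>" "r k < \<eta> * \<delta>" "r k powr (1 - \<alpha>) < \<eta> * \<gamma>"
    by (elim exE conjE)
  have empty_k: "\<exists>i\<in>I. x + a i k \<notin> \<Omega> i" if "dist xbar x \<le> \<gamma> * r k powr \<alpha>" for x
  proof (rule ccontr)
    assume "\<not> ?thesis"
    then have "x \<in> (\<Inter>i\<in>I. (\<lambda>w. w - a i k) ` \<Omega> i)"
      by (force intro: image_eqI[where x = "x + a _ k"])
    with k(1) that show False
      unfolding disjoint_iff mem_cball by blast
  qed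
  \<comment> \<open>With all translations zero, \<open>xbar\<close> itself would be a common point
    in the ball.\<close>
  have "r k > 0"
  proof (rule ccontr)
    assume "\<not> r k > 0"
    then have "a i k = 0" if "i \<in> I" for i
      using r[OF that, of k] norm_ge_zero[of "a i k"] by (metis norm_le_zero_iff not_less order_trans)
    then show False
      using empty_k[of xbar] xbar \<open>\<gamma> > 0\<close> by auto
  qed
  txt \<open>For \<open>\<alpha> = 0\<close> the radius of extremality does not shrink, hence the cut-off at \<open>\<delta>\<close>.\<close>
  define R where "R = min (\<gamma> * r k powr \<alpha>) \<delta>"
  have "R > 0"
    using \<open>\<gamma> > 0\<close> \<open>r k > 0\<close> \<open>\<delta> > 0\<close> by (simp add: R_def)
  have "r k = r k powr (1 - \<alpha>) * r k powr \<alpha>"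
    using \<open>r k > 0\<close> by (simp add: powr_add[symmetric])
  also have "\<dots> < \<eta> * \<gamma> * r k powr \<alpha>"
    using k(4) \<open>r k > 0\<close> by (intro mult_strict_right_mono) auto
  finally have "r k < \<eta> * R"
    using k(3) by (simp add: R_def min_def mult.assoc)
  then have rate: "4 * sqrt (card I) * r k / R < e"
    using \<open>R > 0\<close> \<open>m \<ge> 1\<close> by (simp add: \<eta>_def I(3) field_simps)
  have radius: "2 * (R + r k) < \<rho>" "2 * (R + r k) < e"
    using k(2) \<open>\<delta> > 0\<close> by (auto simp: R_def \<delta>_def min_def split: if_splits)
  have empty_R: "\<exists>i\<in>I. x + a i k \<notin> \<Omega> i" if "dist xbar x \<le> R" for x
    using empty_k[of x] that by (simp add: R_def)
  obtain w y where wy: "\<forall>i\<in>I. dist xbar (w i) \<le> 2 * (R + r k)"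
    "\<forall>i\<in>I. y i \<in> eps_normals 0 (w i) (\<Omega> i)"
    "norm (\<Sum>i\<in>I. y i) \<le> 4 * sqrt (card I) * r k / R" "(\<Sum>i\<in>I. (norm (y i))\<^sup>2) = 1"
    using translated_sets_approximate_normals[OF I(1,2) \<rho>(2) xbar \<open>r k > 0\<close> \<open>R > 0\<close>
        radius(1) r empty_R] by blast
  show ?thesis
    unfolding I_def[symmetric]
  proof (intro exI conjI ballI)
    show "dist xbar (w i) < e" if "i \<in> I" for i
      using wy(1) that radius(2) le_less_trans by blast
    show "y i \<in> eps_normals 0 (w i) (\<Omega> i)" if "i \<in> I" for i
      using wy(2) that by blast
    show "norm (\<Sum>i\<in>I. y i) < e"
      using wy(3) rate by (rule le_less_trans)
  qed (fact wy(4))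
qed

section \<open>Passage to the limit\<close>

theorem theorem3p5:
  fixes m :: nat and \<Omega> :: "nat \<Rightarrow> (real ^ 'n) set" and xbar :: "real ^ 'n" and \<alpha> :: real
  assumes "m \<ge> 2"
    and "rated_extremal_point \<alpha> m \<Omega> xbar"
    and "\<forall>i\<in>{1..m}. locally_closed_around (\<Omega> i) xbar"
  shows "\<exists>x :: nat \<Rightarrow> real ^ 'n.
           (\<forall>i\<in>{1..m}. x i \<in> limiting_normal_cone xbar (\<Omega> i)) \<and>
           (\<Sum>i=1..m. x i) = 0 \<and> (\<Sum>i=1..m. (norm (x i))\<^sup>2) = 1"
proof -
  have "\<exists>w y. (\<forall>i\<in>{1..m}. dist xbar (w i) < inverse (real (Suc k))
        \<and> y i \<in> eps_normals 0 (w i) (\<Omega> i))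
      \<and> norm (\<Sum>i=1..m. y i) < inverse (real (Suc k)) \<and> (\<Sum>i=1..m. (norm (y i))\<^sup>2) = 1" for k
    using assms by (intro rated_extremal_approximate_normals[OF _ assms(2,3)]) simp_all
  then obtain w y where wy:
    "\<And>k i. i \<in> {1..m} \<Longrightarrow> dist xbar (w k i) < inverse (real (Suc k))"
    "\<And>k i. i \<in> {1..m} \<Longrightarrow> y k i \<in> eps_normals 0 (w k i) (\<Omega> i)"
    "\<And>k. norm (\<Sum>i=1..m. y k i) < inverse (real (Suc k))"
    "\<And>k. (\<Sum>i=1..m. (norm (y k i))\<^sup>2) = 1"
    by metis
  \<comment> \<open>The normalization bounds every single normal by one, which provides the
    compactness.\<close>
  have "bounded (range (\<lambda>k. y k i))" if "i \<in> {1..m}" for i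
  proof -
    have "(norm (y k i))\<^sup>2 \<le> 1" for k
      unfolding wy(4)[of k, symmetric] using that by (intro member_le_sum) auto
    then show ?thesis
      by (auto simp: bounded_iff abs_square_le_1 intro!: exI[of _ 1])
  qed
  then obtain s l where s: "strict_mono s" and l: "\<forall>i\<in>{1..m}. ((\<lambda>k. y k i) \<circ> s) \<longlonglongrightarrow> l i"
    using common_convergent_subsequence[of "{1..m}" "\<lambda>i k. y k i"] by auto
  have l: "(\<lambda>k. y (s k) i) \<longlonglongrightarrow> l i" if "i \<in> {1..m}" for i
    using l that by (simp add: o_def)
  have small: "(\<lambda>k. inverse (real (Suc (s k)))) \<longlonglongrightarrow> 0"
    using LIMSEQ_subseq_LIMSEQ[OF LIMSEQ_inverse_real_of_nat s] by (simp add: o_def)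
  have "l i \<in> limiting_normal_cone xbar (\<Omega> i)" if i: "i \<in> {1..m}" for i
  proof -
    have "(\<lambda>k. dist (w (s k) i) xbar) \<longlonglongrightarrow> 0"
    proof (rule Lim_null_comparison[OF always_eventually[OF allI] small])
      show "norm (dist (w (s k) i) xbar) \<le> inverse (real (Suc (s k)))" for k
        using less_imp_le[OF wy(1)[OF i, of "s k"]]
        by (simp only: real_norm_def abs_of_nonneg[OF zero_le_dist] dist_commute[of _ xbar])
    qed
    then have "(\<lambda>k. w (s k) i) \<longlonglongrightarrow> xbar"
      by (rule tendsto_dist_iff[THEN iffD2])
    \<comment> \<open>The approximating vectors are regular normals with tolerance zero, so the
      constant sequence \<open>0\<close> serves for \<open>\<epsilon>\<close>.\<close>
    then show ?thesis
      unfolding limiting_normal_cone_def using l[OF i] wy(2)[OF i]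
      by (intro CollectI exI[of _ "\<lambda>_. 0"] exI[of _ "\<lambda>k. w (s k) i"] exI[of _ "\<lambda>k. y (s k) i"])
        (simp add: decseq_def)
  qed
  moreover have "(\<Sum>i=1..m. l i) = 0"
  proof (rule LIMSEQ_unique)
    show "(\<lambda>k. \<Sum>i=1..m. y (s k) i) \<longlonglongrightarrow> (\<Sum>i=1..m. l i)"
      using l by (rule tendsto_sum)
    show "(\<lambda>k. \<Sum>i=1..m. y (s k) i) \<longlonglongrightarrow> 0"
      using wy(3) by (intro Lim_null_comparison[OF _ small] always_eventually allI less_imp_le)
  qed
  \<comment> \<open>In finite dimension the normals converge in norm, so the normalization survives
    and the limits cannot all vanish.\<close>
  moreover have "(\<Sum>i=1..m. (norm (l i))\<^sup>2) = 1"
  proof (rule LIMSEQ_unique)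
    show "(\<lambda>k. \<Sum>i=1..m. (norm (y (s k) i))\<^sup>2) \<longlonglongrightarrow> (\<Sum>i=1..m. (norm (l i))\<^sup>2)"
      using l by (intro tendsto_sum tendsto_power tendsto_norm)
    show "(\<lambda>k. \<Sum>i=1..m. (norm (y (s k) i))\<^sup>2) \<longlonglongrightarrow> 1"
      by (simp only: wy(4) tendsto_const)
  qed
  ultimately show ?thesis
    by blast
qed

end
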